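(* Let $S$ be a lower subsemigroup of the bicyclic monoid $\mathcal{B}$, written as $S=F_D\cup\bigcup_{i\in I}\widehat{S_i}$ with associated parameters $d$ and $I$. Then $S$ is a left I-order in $\mathcal{B}$ if and only if $d=1$ and $I=\mathbb{N}^0$.
   Context: The bicyclic monoid $\mathcal{B}$ is the monoid generated by $a,b$ subject to $ba=1$; its elements are uniquely of the form $a^ib^j$ with $i,j\ge 0$, with $a^kb^l\,a^mb^n=a^{k-l+t}b^{n-m+t}$ where $t=\max\{l,m\}$. It is an inverse monoid with $(a^ib^j)^{-1}=a^jb^i$. A subsemigroup $S$ of an inverse semigroup $Q$ is a left I-order in $Q$ if every element of $Q$ can be written as $s^{-1}t$ with $s,t\in S$. Notation: $\mathbb{N}$ is the set of positive integers, $\mathbb{N}^0=\mathbb{N}\cup\{0\}$; $D=\{a^ib^i: i\ge 0\}$; $L^p=\{a^ib^j: 0\le j\le p,\ i\ge 0\}$; for $i,m\ge 0$ and $d>0$, $\Lambda_{i,m,d}=\{a^ib^j : d\mid j-i,\ j\ge m\}$; for $X\subseteq\mathcal{B}$, $\widehat{X}=\{a^jb^i : a^ib^j\in X\}$. A lower subsemigroup of $\mathcal{B}$ is a subsemigroup $S$ of the form $S=F_D\cup\bigcup_{i\in I}\widehat{S_i}$, where $d\in\mathbb{N}$, $\emptyset\ne I\subseteq\mathbb{N}^0$, $F_D\subseteq D\cap L^{\min(I)}$, and for each $i\in I$, $S_i\subseteq\Lambda_{i,i,d}$ has the form $S_i=F_i\cup\Lambda_{i,m_i,d}$ for some $m_i\in\mathbb{N}^0$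 and some finite set $F_i$; moreover $I=I_0\cup\{r+ud : r\in R,\ u\in\mathbb{N}^0,\ r+ud\ge N\}$ for some (possibly empty) $R\subseteq\{0,\dots,d-1\}$, some $N\in\mathbb{N}^0$ and some finite $I_0\subseteq\{0,\dots,N-1\}$. *)

theory Defs
  imports Main
begin

class inverse_semigroup = semigroup_mult +
  fixes sinv :: "'a \<Rightarrow> 'a"
  assumes mult_sinv_mult: "x * sinv x * x = x"
    and sinv_mult_sinv: "sinv x * x * sinv x = sinv x"
    and sinv_unique: "x * y * x = x \<Longrightarrow> y * x * y = y \<Longrightarrow> y = sinv x"

definition subsemigroup :: "'a::semigroup_mult set \<Rightarrow> bool" where
  "subsemigroup S \<longleftrightarrow> S \<noteq> {} \<and> (\<forall>x\<in>S. \<forall>y\<in>S. x * y \<in> S)"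

definition left_I_order :: "'a::inverse_semigroup set \<Rightarrow> bool" where
  "left_I_order S \<longleftrightarrow> subsemigroup S \<and> (\<forall>q. \<exists>s\<in>S. \<exists>t\<in>S. q = sinv s * t)"

text \<open>
  The bicyclic monoid, represented by its normal forms: \<open>Bic i j\<close> stands for
  \<open>a\<^sup>i b\<^sup>j\<close>. The lemmas \<open>gen_b_gen_a\<close>, \<open>Bic_eq\<close>, and \<open>bicyclic_universal\<close>
  show that this is the monoid with presentation \<open>\<langle>a, b | ba = 1\<rangle>\<close>.
\<close>

datatype bicyclic = Bic nat nat

instantiation bicyclic :: monoid_mult
begin

definition one_bicyclic :: bicyclic where
  "1 = Bic 0 0"

text \<open>The truncated subtractions are exact because \<open>max l m\<close> dominates both \<open>l\<close> and \<open>m\<close>.\<close>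

fun times_bicyclic :: "bicyclic \<Rightarrow> bicyclic \<Rightarrow> bicyclic" where
  "Bic k l * Bic m n = Bic (k + (max l m - l)) (n + (max l m - m))"

instance
proof
  fix x y z :: bicyclic
  show "x * y * z = x * (y * z)"
  proof (cases x; cases y; cases z)
    fix k l m n p q assume xyz: "x = Bic k l" "y = Bic m n" "z = Bic p q"
    consider e f where "m = l + e" "p = n + f" | e f where "m = l + e" "n = p + f"
      | e f where "l = m + e" "p = n + f" | e f where "l = m + e" "n = p + f"
      using nat_le_linear[of l m] nat_le_linear[of n p] unfolding le_iff_add by blast
    then show ?thesis
    proof cases
      case (3 e f)
      then show ?thesis
        by (cases "e \<le> f") (simp_all add: xyz max_def)
    qed (simp_all add: xyz add.assoc)
  qed
  show "1 * x = x" "x * 1 = x"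
    by (cases x; simp add: one_bicyclic_def)+
qed

end

definition gen_a :: bicyclic where "gen_a = Bic 1 0"
definition gen_b :: bicyclic where "gen_b = Bic 0 1"

lemma gen_b_gen_a: "gen_b * gen_a = 1"
  by (simp add: gen_a_def gen_b_def one_bicyclic_def)

lemma gen_a_power: "gen_a ^ i = Bic i 0"
  by (induction i) (simp_all add: gen_a_def one_bicyclic_def)

lemma gen_b_power: "gen_b ^ j = Bic 0 j"
  by (induction j) (simp_all add: gen_b_def one_bicyclic_def)

lemma Bic_eq: "Bic i j = gen_a ^ i * gen_b ^ j"
  by (simp add: gen_a_power gen_b_power)

lemma bicyclic_universal:
  fixes u v :: "'m::monoid_mult"
  assumes "v * u = 1"
  shows "\<exists>!h :: bicyclic \<Rightarrow> 'm.
    h 1 = 1 \<and> (\<forall>x y. h (x * y) = h x * h y) \<and> h gen_a = u \<and> h gen_b = v"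
proof (rule ex1I)
  define h where "h x = (case x of Bic i j \<Rightarrow> u ^ i * v ^ j)" for x
  have step: "v ^ Suc l * (u ^ Suc m * w) = v ^ l * (u ^ m * w)" for l m and w :: 'm
  proof -
    have "v ^ Suc l * (u ^ Suc m * w) = v ^ l * ((v * u) * (u ^ m * w))"
      unfolding power_Suc2[of v] power_Suc[of u] by (simp add: mult.assoc)
    then show ?thesis using assms by simp
  qed
  have cancel: "v ^ l * (u ^ m * w) = u ^ (max l m - l) * (v ^ (max l m - m) * w)"
    for l m and w :: 'm
  proof (induction l arbitrary: m)
    case 0
    then show ?case by simp
  next
    case (Suc l)
    show ?case
    proof (cases m)
      case 0
      then show ?thesis by simp
    next
      case (Suc m')
      then show ?thesis using Suc.IH[of m'] step[of l m' w] by simp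
    qed
  qed
  have "h (Bic k l * Bic m n) = h (Bic k l) * h (Bic m n)" for k l m n
  proof -
    have "h (Bic k l) * h (Bic m n) = u ^ k * (v ^ l * (u ^ m * v ^ n))"
      by (simp add: h_def mult.assoc)
    also have "\<dots> = u ^ (k + (max l m - l)) * v ^ ((max l m - m) + n)"
      by (simp only: cancel[of l m] power_add mult.assoc)
    finally show ?thesis
      by (simp add: h_def add.commute)
  qed
  then have "h (x * y) = h x * h y" for x y
    by (metis bicyclic.exhaust)
  then show "h 1 = 1 \<and> (\<forall>x y. h (x * y) = h x * h y) \<and> h gen_a = u \<and> h gen_b = v"
    by (simp add: h_def one_bicyclic_def gen_a_def gen_b_def)
  fix g :: "bicyclic \<Rightarrow> 'm"
  assume g: "g 1 = 1 \<and> (\<forall>x y. g (x * y) = g x * g y) \<and> g gen_a = u \<and> g gen_b = v"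
  have "g (gen_a ^ i) = u ^ i" "g (gen_b ^ i) = v ^ i" for i
    by (induction i) (simp_all add: g)
  then have "g (Bic i j) = h (Bic i j)" for i j
    by (simp add: Bic_eq[of i j] g) (simp add: h_def gen_a_power gen_b_power)
  then show "g = h"
    by (metis bicyclic.exhaust ext)
qed

lemma bicyclic_regularD:
  assumes "Bic i j * Bic k l * Bic i j = Bic i j"
  shows "k \<le> j" "l + (j - k) = i"
proof -
  define t where "t = max j k"
  define t' where "t' = max (l + (t - k)) i"
  have "i + (t - j) + (t' - (l + (t - k))) = i" "j + (t' - i) = j"
    using assms unfolding t_def t'_def times_bicyclic.simps bicyclic.inject by blast+
  then have "t - j = 0" "t' - (l + (t - k)) = 0" "t' - i = 0"
    by (simp_all only: add.assoc add_eq_self_zero add_is_0)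
  then have "t \<le> j" "t' \<le> l + (t - k)" "t' \<le> i"
    by (simp_all only: diff_is_0_eq)
  moreover have "j \<le> t" "k \<le> t" "l + (t - k) \<le> t'" "i \<le> t'"
    by (simp_all add: t_def t'_def)
  ultimately have "t = j" "k \<le> t" "t' = l + (t - k)" "t' = i"
    by (simp_all only: order.antisym)
  then show "k \<le> j" "l + (j - k) = i"
    by simp_all
qed

instantiation bicyclic :: inverse_semigroup
begin

fun sinv_bicyclic :: "bicyclic \<Rightarrow> bicyclic" where
  "sinv (Bic i j) = Bic j i"

instance
proof
  fix x y :: bicyclic
  show "x * sinv x * x = x" "sinv x * x * sinv x = sinv x"
    by (cases x; simp)+
  show "y = sinv x" if "x * y * x = x" "y * x * y = y"
  proof (cases x; cases y)
    fix i j k l assume xy: "x = Bic i j" "y = Bic k l"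
    have "k \<le> j" "i \<le> l" "l + (j - k) = i"
      using bicyclic_regularD[OF that(1)[unfolded xy]] bicyclic_regularD[OF that(2)[unfolded xy]]
      by simp_all
    then have "j = k" "l = i"
      by simp_all
    then show "y = sinv x" by (simp add: xy)
  qed
qed

end

definition bic_D :: "bicyclic set" where
  "bic_D = {Bic i i | i. True}"

definition bic_L :: "nat \<Rightarrow> bicyclic set" where
  "bic_L p = {Bic i j | i j. j \<le> p}"

definition bic_Lambda :: "nat \<Rightarrow> nat \<Rightarrow> nat \<Rightarrow> bicyclic set" where
  "bic_Lambda i m d = {Bic i j | j. int d dvd int j - int i \<and> m \<le> j}"

definition bic_hat :: "bicyclic set \<Rightarrow> bicyclic set" where
  "bic_hat X = {Bic j i | i j. Bic i j \<in> X}"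

text \<open>\<open>lower_subsemigroup S d I\<close>: \<open>S\<close> is a lower subsemigroup and \<open>d\<close>, \<open>I\<close> are the
  parameters of some decomposition of \<open>S\<close> of the required form, in which \<open>T i\<close> is
  the set usually written \<open>S\<^sub>i\<close>.\<close>

definition lower_subsemigroup :: "bicyclic set \<Rightarrow> nat \<Rightarrow> nat set \<Rightarrow> bool" where
  "lower_subsemigroup S d I \<longleftrightarrow>
     subsemigroup S \<and> d > 0 \<and> I \<noteq> {} \<and>
     (\<exists>F_D T.
        S = F_D \<union> (\<Union>i\<in>I. bic_hat (T i)) \<and>
        F_D \<subseteq> bic_D \<inter> bic_L (LEAST i. i \<in> I) \<and>
        (\<forall>i\<in>I. T i \<subseteq> bic_Lambda i i d \<and>
           (\<exists>m F. finite F \<and> T i = F \<union> bic_Lambda i m d))) \<and>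
     (\<exists>R N I0. R \<subseteq> {..<d} \<and> finite I0 \<and> I0 \<subseteq> {..<N} \<and>
        I = I0 \<union> {r + u * d | r u. r \<in> R \<and> r + u * d \<ge> N})"

end

theory Submission
  imports Defs
begin

text \<open>In a product \<open>s\<^sup>-\<^sup>1 t\<close> with \<open>s = a\<^sup>xb\<^sup>y\<close> and \<open>t = a\<^sup>zb\<^sup>w\<close> the exponent of \<open>a\<close> is \<open>y\<close> if
  \<open>x \<ge> z\<close>, and the exponent of \<open>b\<close> is \<open>w\<close> if \<open>x \<le> z\<close>. Writing \<open>b\<close> in this form yields \<open>d = 1\<close>
  and \<open>0 \<in> I\<close>, and writing \<open>a\<^sup>kb\<^sup>k\<close> in this form yields \<open>k \<in> I\<close>. Conversely, for
  \<open>i \<in> I\<close> the set \<open>S\<close> contains all \<open>a\<^sup>xb\<^sup>i\<close> with \<open>x\<close> large and \<open>d dvd x - i\<close>, and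
  \<open>a\<^sup>kb\<^sup>n = (a\<^sup>xb\<^sup>k)\<^sup>-\<^sup>1 (a\<^sup>xb\<^sup>n)\<close>.\<close>

text \<open>Elements of \<open>F_D\<close> are diagonal, so they satisfy the first two claims and
  the second alternative of the third. All others come from some \<open>bic_Lambda k k d\<close>
  with \<open>k \<in> I\<close>.\<close>

lemma lower_subsemigroup_mem:
  assumes "lower_subsemigroup S d I" and "Bic j i \<in> S"
  shows "i \<le> j" and "int d dvd int j - int i"
    and "i \<in> I \<or> i = j \<and> i \<le> (LEAST i. i \<in> I)"
proof -
  obtain F_D T where S: "S = F_D \<union> (\<Union>i\<in>I. bic_hat (T i))"
    and F: "F_D \<subseteq> bic_D \<inter> bic_L (LEAST i. i \<in> I)"
    and T: "\<forall>i\<in>I. T i \<subseteq> bic_Lambda i i d"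
    using assms(1) unfolding lower_subsemigroup_def by (elim conjE exE) simp
  have "Bic j i \<in> bic_D \<inter> bic_L (LEAST i. i \<in> I) \<or> (\<exists>k\<in>I. Bic i j \<in> bic_Lambda k k d)"
  proof -
    consider "Bic j i \<in> F_D" | k where "k \<in> I" "Bic j i \<in> bic_hat (T k)"
      using assms(2) S by auto
    then show ?thesis
    proof cases
      case 1
      with F show ?thesis by blast
    next
      case (2 k)
      then have "Bic i j \<in> T k"
        by (simp add: bic_hat_def)
      with T 2(1) show ?thesis by blast
    qed
  qed
  then show "i \<le> j" "int d dvd int j - int i" "i \<in> I \<or> i = j \<and> i \<le> (LEAST i. i \<in> I)"
    by (auto simp: bic_D_def bic_L_def bic_Lambda_def)
qed

lemma lower_subsemigroup_eventually_mem:
  assumes "lower_subsemigroup S d I" and "i \<in> I"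
  obtains m where "\<And>j. m \<le> j \<Longrightarrow> int d dvd int j - int i \<Longrightarrow> Bic j i \<in> S"
proof -
  obtain F_D T where S: "S = F_D \<union> (\<Union>i\<in>I. bic_hat (T i))"
    and T: "\<forall>i\<in>I. T i \<subseteq> bic_Lambda i i d \<and> (\<exists>m F. finite F \<and> T i = F \<union> bic_Lambda i m d)"
    using assms(1) unfolding lower_subsemigroup_def by (elim conjE exE) simp
  obtain m where m: "bic_Lambda i m d \<subseteq> T i"
    using T assms(2) by blast
  have "Bic j i \<in> S" if "m \<le> j" "int d dvd int j - int i" for j
  proof -
    have "Bic i j \<in> bic_Lambda i m d"
      using that by (simp add: bic_Lambda_def)
    with m have "Bic j i \<in> bic_hat (T i)"
      by (auto simp: bic_hat_def)
    with assms(2) show ?thesis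
      unfolding S by blast
  qed
  then show thesis by (rule that)
qed

lemma left_I_orderE:
  assumes "left_I_order S"
  obtains x y z w where "Bic x y \<in> S" "Bic z w \<in> S"
    "k = y + (max x z - x)" "n = w + (max x z - z)"
proof -
  obtain s t where st: "s \<in> S" "t \<in> S" "Bic k n = sinv s * t"
    using assms unfolding left_I_order_def by blast
  show thesis
    using st by (cases s; cases t) (auto intro: that)
qed

theorem proposition4p4:
  fixes S :: "bicyclic set" and d :: nat and I :: "nat set"
  assumes "lower_subsemigroup S d I"
  shows "left_I_order S \<longleftrightarrow> d = 1 \<and> I = UNIV"
proof
  note mem = lower_subsemigroup_mem[OF assms]
  assume order: "left_I_order S"
  obtain x y z w where xy: "Bic x y \<in> S" and zw: "Bic z w \<in> S"
    and eq: "0 = y + (max x z - x)" "1 = w + (max x z - z)"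
    using left_I_orderE[OF order] by blast
  have "y = 0" "z \<le> x" and x: "x + w = z + 1"
    using eq by (simp_all add: max_def split: if_splits)
  \<comment> \<open>Both exponent differences are multiples of \<open>d\<close>, so \<open>d\<close>
    divides 1.\<close>
  have "int x - int y - (int z - int w) = 1"
    using \<open>y = 0\<close> x by simp
  then have "int d dvd 1"
    using dvd_diff[OF mem(2)[OF xy] mem(2)[OF zw]] by simp
  then have "d = 1"
    by simp
  \<comment> \<open>Otherwise \<open>z = 0\<close> and \<open>w = 1\<close>, against
    \<open>w \<le> z\<close>. Thus \<open>Bic x 0\<close> is off the diagonal.\<close>
  have "x \<noteq> 0"
    using mem(1)[OF zw] \<open>z \<le> x\<close> x by simp
  then have "0 \<in> I"
    using mem(3)[OF xy] \<open>y = 0\<close> by simp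
  then have least: "(LEAST i. i \<in> I) = 0"
    by simp
  have "k \<in> I" for k
  proof -
    obtain x y z w where xy: "Bic x y \<in> S" and zw: "Bic z w \<in> S"
      and eq: "k = y + (max x z - x)" "k = w + (max x z - z)"
      using left_I_orderE[OF order] by blast
    have "k = y \<or> k = w"
      using eq by (simp add: max_def split: if_splits)
    \<comment> \<open>The diagonal alternative now leaves only the exponent 0, itself in
      \<open>I\<close>.\<close>
    then show ?thesis
      using mem(3)[OF xy] mem(3)[OF zw] \<open>0 \<in> I\<close> unfolding least by auto
  qed
  with \<open>d = 1\<close> show "d = 1 \<and> I = UNIV"
    by blast
next
  assume dI: "d = 1 \<and> I = UNIV"
  have "\<exists>s\<in>S. \<exists>t\<in>S. q = sinv s * t" for q
  proof (cases q)
    case (Bic k n)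
    obtain m where m: "\<And>j. m \<le> j \<Longrightarrow> Bic j k \<in> S"
      using lower_subsemigroup_eventually_mem[OF assms, of k] dI by auto
    obtain m' where m': "\<And>j. m' \<le> j \<Longrightarrow> Bic j n \<in> S"
      using lower_subsemigroup_eventually_mem[OF assms, of n] dI by auto
    \<comment> \<open>The common exponent of \<open>a\<close> must pass both thresholds; for
      \<open>d = 1\<close> divisibility is automatic.\<close>
    have "q = sinv (Bic (max m m') k) * Bic (max m m') n"
      by (simp add: Bic)
    moreover have "Bic (max m m') k \<in> S" "Bic (max m m') n \<in> S"
      by (simp_all add: m m')
    ultimately show ?thesis
      by blast
  qed
  moreover have "subsemigroup S"
    using assms by (simp add: lower_subsemigroup_def)
  ultimately show "left_I_order S"
    by (simp add: left_I_order_def)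
qed

end
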